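(* Let $K_1$ and $K_2$ be compact countable subsets of $\mathbb{R}$ such that $\mathcal{CB}(K_1)=\mathcal{CB}(K_2)$. Then $K_1\sim K_2$.
   Context: A countable set is one that is either finite (possibly empty) or countably infinite; $\omega$ is the set of natural numbers (including $0$) and $\Omega$ is the set of all countable ordinals. $\mathcal{K}$ denotes the set of compact countable subsets of $\mathbb{R}$. For $K_1,K_2\in\mathcal{K}$, $K_1\sim K_2$ means that there exists a continuous bijection $f\colon K_1\to K_2$ (equivalently, by compactness, a homeomorphism), where subsets of $\mathbb{R}$ carry the subspace topology. For $A\subset\mathbb{R}$, $A'$ denotes the derived set (set of all limit points) of $A$, and the Cantor-Bendixson derivatives are defined by transfinite recursion: $A^{(0)}=A$; $A^{(\beta+1)}=(A^{(\beta)})'$ for every ordinal $\beta$; $A^{(\lambda)}=\bigcap_{\gamma<\lambda}A^{(\gamma)}$ for every limit ordinal $\lambda\neq 0$. For every $K\in\mathcal{K}$ there is a countable ordinal $\beta$ with $K^{(\beta)}$ finite (a theorem of Cantor). The Cantor-Bendixson characteristic of $K\in\mathcal{K}$ is the pair $\mathcal{CB}(K)=(\alpha,p)\in\Omega\times\omega$, where $\alpha$ is the smallest countable ordinal such that $K^{(\alpha)}$ is finite and $p=|K^{(\alpha)}|$. *)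

theory Defs
  imports "HOL-Analysis.Analysis" "HOL-Library.Countable_Set_Type"
begin

text \<open>
  The countable ordinals are realised as the elements of the initial well-order of type
  \<open>\<omega>\<^sub>1\<close>, i.e. of the cardinal successor of \<^const>\<open>natLeq\<close>. The lemmas
  \<open>countable_below_cord\<close>, \<open>uncountable_cord\<close> and \<open>countable_well_order_cord\<close> below show that
  this well-order is exactly the one meant: all proper initial segments are countable, the whole
  is not, and each countable well-order is isomorphic to a proper initial segment.
\<close>

typedef cord = "Field (cardSuc natLeq)"
  using Field_cardSuc_not_empty[OF natLeq_Card_order] by blast

lemma cardSuc_natLeq_Well_order: "Well_order (cardSuc natLeq)"
  using cardSuc_Card_order[OF natLeq_Card_order] card_order_on_well_order_on by blast

lemma cardSuc_natLeq_wo_rel: "wo_rel (cardSuc natLeq)"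
  unfolding wo_rel_def by (rule cardSuc_natLeq_Well_order)

instantiation cord :: wellorder
begin

definition less_eq_cord :: "cord \<Rightarrow> cord \<Rightarrow> bool"
  where "a \<le> b \<longleftrightarrow> (Rep_cord a, Rep_cord b) \<in> cardSuc natLeq"

definition less_cord :: "cord \<Rightarrow> cord \<Rightarrow> bool"
  where "(a::cord) < b \<longleftrightarrow> a \<le> b \<and> a \<noteq> b"

instance
proof
  fix a b c :: cord
  note wo = cardSuc_natLeq_wo_rel
  show refl: "a \<le> a"
    unfolding less_eq_cord_def by (rule refl_onD[OF wo_rel.REFL[OF wo] Rep_cord])
  have antisym: "x = y" if "x \<le> y" "y \<le> x" for x y :: cord
    using antisymD[OF wo_rel.ANTISYM[OF wo] that[unfolded less_eq_cord_def]]
    by (simp add: Rep_cord_inject)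
  show "a < b \<longleftrightarrow> a \<le> b \<and> \<not> b \<le> a"
    unfolding less_cord_def using antisym[of a b] refl by auto
  show "a \<le> c" if "a \<le> b" "b \<le> c"
    using that unfolding less_eq_cord_def by (rule transD[OF wo_rel.TRANS[OF wo]])
  show "a = b" if "a \<le> b" "b \<le> a"
    using antisym that .
  show "a \<le> b \<or> b \<le> a"
    unfolding less_eq_cord_def
    by (rule wo_rel.TOTALS[OF wo, THEN bspec, THEN bspec, OF Rep_cord Rep_cord])
  show "P a" if step: "\<And>x. (\<And>y. y < x \<Longrightarrow> P y) \<Longrightarrow> P x" for P
  proof -
    have "wf (inv_image (cardSuc natLeq - Id) Rep_cord)"
      by (rule wf_inv_image[OF wo_rel.WF[OF wo]])
    then show ?thesis
    proof (induction a rule: wf_induct_rule)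
      case (less x)
      show ?case
        by (rule step, rule less)
          (auto simp: less_cord_def less_eq_cord_def Rep_cord_inject)
    qed
  qed
qed

end

lemma Rep_cord_image_lessThan: "Rep_cord ` {..<a} = underS (cardSuc natLeq) (Rep_cord a)"
proof (intro equalityI subsetI)
  fix x assume "x \<in> underS (cardSuc natLeq) (Rep_cord a)"
  then have x: "x \<noteq> Rep_cord a" "(x, Rep_cord a) \<in> cardSuc natLeq"
    and "x \<in> Field (cardSuc natLeq)"
    by (auto simp: underS_def Field_def)
  from this(3) obtain b where "x = Rep_cord b"
    by (rule Rep_cord_cases)
  with x show "x \<in> Rep_cord ` {..<a}"
    by (auto simp: less_cord_def less_eq_cord_def)
qed (auto simp: underS_def less_cord_def less_eq_cord_def Rep_cord_inject)

context
  includes cardinal_syntax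
begin

lemma countable_below_cord: "countable {..<a::cord}"
proof -
  have "|underS (cardSuc natLeq) (Rep_cord a)| <o cardSuc natLeq"
    by (rule card_of_underS[OF cardSuc_Card_order[OF natLeq_Card_order] Rep_cord])
  then have "|underS (cardSuc natLeq) (Rep_cord a)| \<le>o natLeq"
    using cardSuc_ordLeq_ordLess[OF natLeq_Card_order card_of_Card_order] by blast
  then have "countable (Rep_cord ` {..<a})"
    unfolding Rep_cord_image_lessThan countable_card_le_natLeq .
  then show ?thesis
    by (rule countable_image_inj_on) (simp add: inj_on_def Rep_cord_inject)
qed

lemma uncountable_Field_cardSuc_natLeq: "\<not> countable (Field (cardSuc natLeq))"
proof
  assume "countable (Field (cardSuc natLeq))"
  then have "|Field (cardSuc natLeq)| \<le>o natLeq"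
    by (simp add: countable_card_le_natLeq)
  then have "cardSuc natLeq \<le>o natLeq"
    using card_of_Field_ordIso[OF cardSuc_Card_order[OF natLeq_Card_order]]
      ordIso_symmetric ordIso_ordLeq_trans by blast
  then show False
    using cardSuc_greater[OF natLeq_Card_order] not_ordLess_ordLeq by blast
qed

lemma uncountable_cord: "uncountable (UNIV :: cord set)"
proof
  assume "countable (UNIV :: cord set)"
  then have "countable (range Rep_cord)"
    by (rule countable_image)
  moreover have "range Rep_cord = Field (cardSuc natLeq)"
    by (rule type_definition.Rep_range[OF type_definition_cord])
  ultimately show False
    using uncountable_Field_cardSuc_natLeq by simp
qed

lemma countable_well_order_cord:
  assumes r: "Well_order r" and cnt: "countable (Field r)"
  obtains a :: cord and f where "bij_betw f (Field r) {..<a}"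
    and "\<And>x y. x \<in> Field r \<Longrightarrow> y \<in> Field r \<Longrightarrow> (x, y) \<in> r \<longleftrightarrow> f x \<le> f y"
proof -
  let ?s = "cardSuc natLeq"
  have "\<not> ?s \<le>o r"
  proof
    assume "?s \<le>o r"
    then have "|Field ?s| \<le>o |Field r|"
      by (rule card_of_mono2)
    also have "|Field r| \<le>o natLeq"
      using cnt by (simp add: countable_card_le_natLeq)
    finally show False
      using uncountable_Field_cardSuc_natLeq by (simp add: countable_card_le_natLeq)
  qed
  then have "r <o ?s"
    using not_ordLeq_iff_ordLess cardSuc_natLeq_Well_order r by blast
  then obtain b where b: "b \<in> Field ?s" "r =o Restr ?s (underS ?s b)"
    using ordLess_iff_ordIso_Restr[OF cardSuc_natLeq_Well_order r] by blast
  then obtain g where "iso r (Restr ?s (underS ?s b)) g"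
    unfolding ordIso_def by blast
  moreover have "Field (Restr ?s (underS ?s b)) = underS ?s b"
    using wo_rel.underS_ofilter[OF cardSuc_natLeq_wo_rel]
      Field_Restr_ofilter[OF cardSuc_natLeq_Well_order] by blast
  ultimately have bij: "bij_betw g (Field r) (underS ?s b)"
    and ord: "\<forall>x\<in>Field r. \<forall>y\<in>Field r. (x, y) \<in> r \<longleftrightarrow> (g x, g y) \<in> Restr ?s (underS ?s b)"
    unfolding iso_iff2 by auto
  obtain a where a: "b = Rep_cord a"
    using b(1) by (rule Rep_cord_cases)
  have bij': "bij_betw (the_inv_into {..<a} Rep_cord) (underS ?s b) {..<a}"
    by (rule bij_betw_the_inv_into)
      (simp add: bij_betw_def inj_on_def Rep_cord_inject Rep_cord_image_lessThan a)
  have rep: "Rep_cord (the_inv_into {..<a} Rep_cord y) = y" if "y \<in> underS ?s b" for y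
    by (rule f_the_inv_into_f)
      (use that in \<open>auto simp: inj_on_def Rep_cord_inject Rep_cord_image_lessThan a\<close>)
  have mem: "g x \<in> underS ?s b" if "x \<in> Field r" for x
    using bij that by (rule bij_betwE[THEN bspec])
  show thesis
  proof
    show "bij_betw (the_inv_into {..<a} Rep_cord \<circ> g) (Field r) {..<a}"
      using bij bij' by (rule bij_betw_trans)
    show "(x, y) \<in> r \<longleftrightarrow>
        (the_inv_into {..<a} Rep_cord \<circ> g) x \<le> (the_inv_into {..<a} Rep_cord \<circ> g) y"
      if "x \<in> Field r" "y \<in> Field r" for x y
      using ord that by (simp add: less_eq_cord_def rep mem)
  qed
qed

end

lemma ex_greater_cord: "\<exists>b. a < (b::cord)"
proof (rule ccontr)
  assume "\<nexists>b. a < b"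
  then have "(UNIV :: cord set) = insert a {..<a}"
    by (auto simp: not_less order_le_less)
  then show False
    using countable_below_cord[of a] uncountable_cord by (metis countable_insert)
qed

definition zero_cord :: cord
  where "zero_cord = (LEAST a. True)"

definition succ_cord :: "cord \<Rightarrow> cord"
  where "succ_cord a = (LEAST b. a < b)"

definition limit_cord :: "cord \<Rightarrow> bool"
  where "limit_cord a \<longleftrightarrow> a \<noteq> zero_cord \<and> (\<forall>b. a \<noteq> succ_cord b)"

lemma zero_cord_le: "zero_cord \<le> a"
  unfolding zero_cord_def by (rule Least_le) simp

lemma less_succ_cord: "a < succ_cord a"
  unfolding succ_cord_def using ex_greater_cord by (rule LeastI_ex)

lemma succ_cord_le_iff: "succ_cord a \<le> b \<longleftrightarrow> a < b"
proof
  show "a < b" if "succ_cord a \<le> b"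
    using less_succ_cord that by (rule less_le_trans)
  show "succ_cord a \<le> b" if "a < b"
    unfolding succ_cord_def using that by (rule Least_le)
qed

lemma succ_cord_inject: "succ_cord a = succ_cord b \<longleftrightarrow> a = b"
  by (metis less_succ_cord linorder_neqE not_less succ_cord_le_iff)

definition derived_set :: "real set \<Rightarrow> real set"
  where "derived_set A = {x. x islimpt A}"

text \<open>
  Transfinite recursion. The three clauses of the usual definition are \<open>CB_deriv_zero\<close>,
  \<open>CB_deriv_succ\<close> and \<open>CB_deriv_limit\<close>.
\<close>

function CB_deriv :: "real set \<Rightarrow> cord \<Rightarrow> real set"
  where
    "CB_deriv A a =
      (if a = zero_cord then A
       else if \<exists>b. a = succ_cord b then derived_set (CB_deriv A (THE b. a = succ_cord b))
       else (\<Inter>c\<in>{..<a}. CB_deriv A c))"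
  by pat_completeness auto
termination
  by (relation "inv_image {(a, b). a < b} snd")
    (auto simp: succ_cord_inject less_succ_cord intro: wf_inv_image wf)

declare CB_deriv.simps [simp del]

lemma CB_deriv_zero: "CB_deriv A zero_cord = A"
  by (simp add: CB_deriv.simps)

lemma CB_deriv_succ: "CB_deriv A (succ_cord b) = derived_set (CB_deriv A b)"
proof -
  have "succ_cord b \<noteq> zero_cord"
    using less_succ_cord[of b] zero_cord_le[of b] by auto
  then show ?thesis
    by (simp add: CB_deriv.simps[of A "succ_cord b"] succ_cord_inject)
qed

lemma CB_deriv_limit: "limit_cord a \<Longrightarrow> CB_deriv A a = (\<Inter>c\<in>{..<a}. CB_deriv A c)"
  by (simp add: CB_deriv.simps[of A a] limit_cord_def)

definition compact_countable_sets :: "real set set"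
  where "compact_countable_sets = {K. compact K \<and> countable K}"

text \<open>
  For \<open>K\<close> in \<^const>\<open>compact_countable_sets\<close> some derivative of countable order is finite, by a
  theorem of Cantor; for other sets the value may be meaningless.
\<close>

definition CB :: "real set \<Rightarrow> cord \<times> nat"
  where "CB K = (let a = (LEAST a. finite (CB_deriv K a)) in (a, card (CB_deriv K a)))"

definition cont_bij_equiv :: "real set \<Rightarrow> real set \<Rightarrow> bool"  (infix \<open>\<sim>\<^sub>K\<close> 50)
  where "K \<sim>\<^sub>K L \<longleftrightarrow> (\<exists>f. continuous_on K f \<and> bij_betw f K L)"

end

theory Submission
  imports Defs
begin

text \<open>
  Induction on the rank \<open>a\<close>. Derivatives commute with passing to clopen pieces, and countability
  makes both spaces zero-dimensional, so \<open>K\<close> splits into clopen pieces whose \<open>a\<close>-th derivative is a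
  single point; hence let \<open>K\<^sup>(\<^sup>a\<^sup>) = {x}\<close> and \<open>L\<^sup>(\<^sup>a\<^sup>) = {y}\<close>. A clopen piece of \<open>K\<close> avoiding \<open>x\<close> has a
  characteristic \<open>(b, q)\<close> with \<open>b < a\<close>. However large a clopen part of \<open>L - {y}\<close> is already used up,
  the \<open>b\<close>-th derivative of the rest is still infinite, and \<open>q\<close> of its isolated points give a clopen
  piece of the same characteristic, homeomorphic by induction. Going back and forth exhausts
  \<open>K - {x}\<close> and \<open>L - {y}\<close> by matching sequences of clopen pieces. The union of the homeomorphisms
  of the pieces extends to \<open>x \<mapsto> y\<close>, since \<open>K\<close> and \<open>L\<close> are one-point compactifications.
\<close>

subsection \<open>Clopen pieces and gluing\<close>

abbreviation clopen_in :: "'a::topological_space set \<Rightarrow> 'a set \<Rightarrow> bool"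
  where "clopen_in K A \<equiv> openin (top_of_set K) A \<and> closedin (top_of_set K) A"

lemma clopen_in_trans:
  assumes "clopen_in A B" "clopen_in K A"
  shows "clopen_in K B"
  using assms openin_trans closedin_trans by blast

lemma clopen_in_compact: "compact K \<Longrightarrow> clopen_in K A \<Longrightarrow> compact A"
  using closedin_compact by blast

lemma clopen_in_subset: "clopen_in K A \<Longrightarrow> A \<subseteq> K"
  using openin_imp_subset by blast

lemma clopen_in_Diff: "clopen_in K A \<Longrightarrow> clopen_in K B \<Longrightarrow> clopen_in K (A - B)"
  by (simp add: openin_diff closedin_diff)

lemma clopen_in_Compl: "clopen_in K A \<Longrightarrow> clopen_in K (K - A)"
  by (simp add: openin_diff closedin_diff)

text \<open>Only countably many radii are distances from \<open>z\<close> to points of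
  \<open>K\<close>, so some radius \<open>r\<close> below \<open>e\<close> is none of them. The open
  and the closed ball of that radius then have the same trace on \<open>K\<close>.\<close>

lemma countable_clopen_base:
  fixes K :: "'a::metric_space set"
  assumes K: "countable K" and z: "z \<in> K" and U: "open U" "z \<in> U"
  obtains A where "clopen_in K A" "z \<in> A" "A \<subseteq> U"
proof -
  obtain e where e: "e > 0" "ball z e \<subseteq> U"
    using U open_contains_ball by blast
  have "uncountable ({0<..<e} - dist z ` K)"
    using K e uncountable_open_interval[of 0 e] by (simp add: uncountable_minus_countable)
  then obtain r where r: "0 < r" "r < e" "r \<notin> dist z ` K"
    by (metis Diff_iff countable_empty ex_in_conv greaterThanLessThan_iff)
  have eq: "K \<inter> ball z r = K \<inter> cball z r"
    using r by force
  show thesis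
  proof
    show "clopen_in K (K \<inter> ball z r)"
      using openin_open_Int[of "ball z r" K] closedin_closed_Int[of "cball z r" K] eq by simp
    show "z \<in> K \<inter> ball z r"
      using z r by simp
    show "K \<inter> ball z r \<subseteq> U"
      using r e by auto
  qed
qed

text \<open>Baire category: if no point were isolated, the complements of the points would be
  countably many dense open sets with empty intersection.\<close>

lemma countable_closed_ex_isolated:
  fixes S :: "'a::{real_normed_vector,heine_borel} set"
  assumes "closed S" "countable S" "S \<noteq> {}"
  shows "\<exists>z\<in>S. \<not> z islimpt S"
proof (rule ccontr)
  assume "\<not> ?thesis"
  then have lim: "z islimpt S" if "z \<in> S" for z
    using that by blast
  have "S \<subseteq> closure (\<Inter>((\<lambda>z. S - {z}) ` S))"
  proof (rule Baire)
    fix T assume "T \<in> (\<lambda>z. S - {z}) ` S"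
    then obtain z where z: "z \<in> S" "T = S - {z}"
      by blast
    have "z \<in> closure (S - {z})"
      using lim[OF z(1)] by (simp add: islimpt_in_closure)
    then show "openin (top_of_set S) T \<and> S \<subseteq> closure T"
      using z closure_subset[of "S - {z}"] by (auto intro: openin_delete)
  qed (use assms in auto)
  moreover have "\<Inter>((\<lambda>z. S - {z}) ` S) = {}"
    using assms(3) by auto
  ultimately show False
    using assms(3) by simp
qed

text \<open>The pasted map is a continuous bijection. Since \<open>K\<close> is compact and
  \<open>L\<close> is Hausdorff, its inverse is continuous automatically.\<close>

lemma homeomorphic_Un_clopen:
  assumes "compact K" "clopen_in K A" "clopen_in L B"
    and "A homeomorphic B" "(K - A) homeomorphic (L - B)"
  shows "K homeomorphic (L :: 'b::t2_space set)"
proof -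
  obtain f f' where f: "homeomorphism A B f f'"
    using assms(4) homeomorphic_def by blast
  obtain g g' where g: "homeomorphism (K - A) (L - B) g g'"
    using assms(5) homeomorphic_def by blast
  have sub: "A \<subseteq> K" "B \<subseteq> L"
    using assms clopen_in_subset by auto
  have im: "f ` A = B" "g ` (K - A) = L - B"
    using f g by (auto simp: homeomorphism_def)
  have inj: "inj_on f A" "inj_on g (K - A)"
    using f g unfolding homeomorphism_def by (metis inj_on_inverseI)+
  let ?h = "\<lambda>z. if z \<in> A then f z else g z"
  have "continuous_on (A \<union> (K - A)) ?h"
  proof (rule continuous_on_cases_local)
    show "closedin (top_of_set (A \<union> (K - A))) A" "closedin (top_of_set (A \<union> (K - A))) (K - A)"
      using sub assms(2) by (auto simp: Un_absorb1 intro!: closedin_diff)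
  qed (use f g in \<open>auto simp: homeomorphism_def\<close>)
  moreover have "A \<union> (K - A) = K"
    using sub by blast
  moreover have "?h ` K = L"
  proof -
    have "?h ` K = f ` A \<union> g ` (K - A)"
      using sub by auto
    then show ?thesis
      using im sub by auto
  qed
  moreover have "inj_on ?h K"
  proof (rule inj_onI)
    fix z w assume zw: "z \<in> K" "w \<in> K" "?h z = ?h w"
    have "z \<in> A \<longleftrightarrow> w \<in> A"
    proof -
      have "?h u \<in> B \<longleftrightarrow> u \<in> A" if "u \<in> K" for u
        using that im by auto
      then show ?thesis
        using zw by metis
    qed
    then show "z = w"
      using zw inj by (auto dest: inj_onD split: if_splits)
  qed
  ultimately show ?thesis
    using homeomorphic_compact[OF assms(1), of ?h L] by simp
qed

text \<open>The pieces are open in \<open>K\<close>, so only continuity at \<open>x\<close> is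
  delicate. If \<open>V\<close> is a neighbourhood of \<open>y\<close>, the compact set
  \<open>L - V\<close> is covered by finitely many \<open>Q n\<close>, and the complement of the
  corresponding \<open>P n\<close> is a neighbourhood of \<open>x\<close> mapped into
  \<open>V\<close>.\<close>

lemma homeomorphic_one_point_compactification:
  fixes K :: "'a::t1_space set" and L :: "'b::t2_space set"
  assumes cpt: "compact K" "compact L" and x: "x \<in> K" and y: "y \<in> L"
    and P: "\<And>n::nat. clopen_in K (P n)" "disjoint_family P" "(\<Union>n. P n) = K - {x}"
    and Q: "\<And>n. clopen_in L (Q n)" "disjoint_family Q" "(\<Union>n. Q n) = L - {y}"
    and hom: "\<And>n. P n homeomorphic Q n"
  shows "K homeomorphic L"
proof -
  have "\<forall>n. \<exists>f. continuous_on (P n) f \<and> f ` P n = Q n \<and> inj_on f (P n)"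
    using hom unfolding homeomorphic_def homeomorphism_def inj_on_def by metis
  then obtain f where f: "\<And>n. continuous_on (P n) (f n)" "\<And>n. f n ` P n = Q n"
      "\<And>n. inj_on (f n) (P n)"
    by metis
  define N where "N z = (THE n. z \<in> P n)" for z
  have N: "N z = n" if "z \<in> P n" for z n
    unfolding N_def using that P(2) by (intro the_equality) (auto simp: disjoint_family_on_def)
  define F where "F z = (if z = x then y else f (N z) z)" for z
  have Fx: "F x = y"
    by (simp add: F_def)
  have FP: "F z = f n z" if "z \<in> P n" for z n
    using that N[OF that] P(3) by (auto simp: F_def)
  have FQ: "F z \<in> Q n" if "z \<in> P n" for z n
    using that f(2) FP by auto
  have cases: "z = x \<or> (\<exists>n. z \<in> P n)" if "z \<in> K" for z
    using that P(3) by auto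
  have yQ: "y \<notin> Q n" for n
    using Q(3) by auto
  have Qeq: "m = n" if "w \<in> Q m" "w \<in> Q n" for w m n
    using that Q(2) by (auto simp: disjoint_family_on_def)
  have "inj_on F K"
  proof (rule inj_onI)
    fix z w assume zw: "z \<in> K" "w \<in> K" "F z = F w"
    consider "z = x" "w = x" | n where "z = x" "w \<in> P n" | n where "z \<in> P n" "w = x"
      | m n where "z \<in> P m" "w \<in> P n"
      using cases[OF zw(1)] cases[OF zw(2)] by blast
    then show "z = w"
    proof cases
      case 4
      then have "m = n"
        using FQ Qeq zw(3) by metis
      then show ?thesis
        using 4 f(3)[of n] FP zw(3) by (metis inj_onD)
    qed (use FQ Fx yQ zw(3) in metis)+
  qed
  moreover have "F ` K = L"
  proof (intro equalityI subsetI)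
    fix w assume "w \<in> F ` K"
    then obtain z where z: "z \<in> K" "w = F z"
      by blast
    then show "w \<in> L"
      using cases[OF z(1)] FQ Q(3) y Fx by blast
  next
    fix w assume w: "w \<in> L"
    show "w \<in> F ` K"
    proof (cases "w = y")
      case True
      then show ?thesis using Fx x by blast
    next
      case False
      then obtain n where "w \<in> Q n"
        using w Q(3) by blast
      then obtain z where "z \<in> P n" "w = F z"
        using f(2) FP by (metis imageE)
      then show ?thesis
        using P(3) by blast
    qed
  qed
  moreover have "continuous_on K F"
    unfolding continuous_on_topological
  proof (intro ballI allI impI)
    fix z V assume z: "z \<in> K" and V: "open V" "F z \<in> V"
    have "\<exists>U. openin (top_of_set K) U \<and> z \<in> U \<and> F ` U \<subseteq> V"
    proof (cases "z = x")
      case True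
      have "compact (L - V)"
        using cpt V by (simp add: compact_diff)
      \<comment> \<open>The \<open>Q n\<close> are only relatively open; open sets
        \<open>T n\<close> with these traces are needed to extract a finite subcover.\<close>
      have "\<exists>T. open T \<and> Q n = L \<inter> T" for n
        using Q(1) openin_open by metis
      then obtain T where T: "\<And>n. open (T n)" "\<And>n. Q n = L \<inter> T n"
        by metis
      have "L - V \<subseteq> (\<Union>n. T n)"
        using Q(3) T(2) True V Fx by blast
      then obtain I where I: "finite I" "L - V \<subseteq> (\<Union>n\<in>I. T n)"
        using compactE_image[OF \<open>compact (L - V)\<close>, of UNIV T] T(1) by metis
      let ?U = "K - (\<Union>n\<in>I. P n)"
      have "openin (top_of_set K) ?U"
        using P(1) I(1) by (intro openin_diff closedin_Union) auto
      moreover have "z \<in> ?U"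
        using z True P(3) by auto
      moreover have "F w \<in> V" if "w \<in> ?U" for w
      proof (rule ccontr)
        assume "F w \<notin> V"
        moreover have "F w \<in> L"
          using \<open>F ` K = L\<close> that by blast
        ultimately obtain n where n: "n \<in> I" "F w \<in> Q n"
          using I(2) T(2) by blast
        have "w \<in> P n"
          using cases[of w] that n FQ Qeq Fx yQ by (metis DiffD1)
        then show False
          using that n by blast
      qed
      ultimately show ?thesis
        by blast
    next
      case False
      then obtain n where n: "z \<in> P n"
        using cases[OF z] by blast
      have "openin (top_of_set (P n)) (P n \<inter> f n -` V)"
        using f(1) V(1) by (rule continuous_openin_preimage_gen)
      then have "openin (top_of_set K) (P n \<inter> f n -` V)"
        using P(1) openin_trans by blast
      then show ?thesis
        using n V(2) FP by (intro exI[of _ "P n \<inter> f n -` V"]) auto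
    qed
    then obtain U where U: "openin (top_of_set K) U" "z \<in> U" "F ` U \<subseteq> V"
      by blast
    then obtain T where "open T" "U = K \<inter> T"
      using openin_open by metis
    then show "\<exists>T. open T \<and> z \<in> T \<and> (\<forall>w\<in>K. w \<in> T \<longrightarrow> F w \<in> V)"
      using U by blast
  qed
  ultimately show ?thesis
    using homeomorphic_compact[OF cpt(1)] by blast
qed

subsection \<open>Cantor-Bendixson derivatives\<close>

lemma cord_cases:
  obtains "a = zero_cord" | b where "a = succ_cord b" | "limit_cord a"
  unfolding limit_cord_def by blast

lemma closed_CB_deriv:
  assumes "closed K"
  shows "closed (CB_deriv K a)"
proof (induction a rule: less_induct)
  case (less a)
  show ?case
  proof (cases a rule: cord_cases)
    case 1
    then show ?thesis using assms by (simp add: CB_deriv_zero)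
  next
    case (2 b)
    then show ?thesis by (simp add: CB_deriv_succ derived_set_def closed_limpts)
  next
    case 3
    then show ?thesis using less by (auto simp: CB_deriv_limit)
  qed
qed

text \<open>Closedness is what makes a derived set lie inside the set itself.\<close>

lemma CB_deriv_antimono:
  assumes "closed K" "a \<le> b"
  shows "CB_deriv K b \<subseteq> CB_deriv K a"
  using assms(2)
proof (induction b rule: less_induct)
  case (less b)
  show ?case
  proof (cases "a = b")
    case True
    then show ?thesis by simp
  next
    case False
    then have "a < b" using less by simp
    show ?thesis
    proof (cases b rule: cord_cases)
      case 1
      then show ?thesis using \<open>a < b\<close> zero_cord_le leD by blast
    next
      case (2 c)
      then have "a \<le> c"
        using \<open>a < b\<close> succ_cord_le_iff[of c a] by (meson not_less)
      then have "CB_deriv K c \<subseteq> CB_deriv K a"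
        using less.IH[of c] 2 less_succ_cord by simp
      moreover have "CB_deriv K b \<subseteq> CB_deriv K c"
        using closed_CB_deriv[OF assms(1), of c]
        by (auto simp: 2 CB_deriv_succ derived_set_def closed_limpt)
      ultimately show ?thesis by simp
    next
      case 3
      then show ?thesis using \<open>a < b\<close> by (auto simp: CB_deriv_limit)
    qed
  qed
qed

lemma CB_deriv_subset: "closed K \<Longrightarrow> CB_deriv K a \<subseteq> K"
  using CB_deriv_antimono[OF _ zero_cord_le] by (simp add: CB_deriv_zero)

text \<open>Openness of \<open>A\<close> makes being a limit point a local matter inside
  \<open>A\<close>, and closedness keeps the limit points of subsets of \<open>A\<close> in
  \<open>A\<close>.\<close>

lemma CB_deriv_clopen_in:
  assumes "closed K" "clopen_in K A"
  shows "CB_deriv A a = CB_deriv K a \<inter> A"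
proof (induction a rule: less_induct)
  case (less a)
  have A: "closed A" "A \<subseteq> K"
    using assms closedin_closed_trans clopen_in_subset[OF assms(2)] by auto
  show ?case
  proof (cases a rule: cord_cases)
    case 1
    then show ?thesis using A by (auto simp: CB_deriv_zero)
  next
    case (2 b)
    obtain T where T: "open T" "A = K \<inter> T"
      using assms openin_open by metis
    have eq: "CB_deriv A b = CB_deriv K b \<inter> A"
      using less 2 less_succ_cord by simp
    also have "\<dots> = CB_deriv K b \<inter> T"
      using T CB_deriv_subset[OF assms(1)] by blast
    finally have eqT: "CB_deriv A b = CB_deriv K b \<inter> T" .
    have "z islimpt CB_deriv A b \<longleftrightarrow> z islimpt CB_deriv K b \<and> z \<in> A" for z
    proof
      assume z: "z islimpt CB_deriv A b"
      then have "z islimpt A"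
        using CB_deriv_subset[OF A(1)] islimpt_subset by blast
      then show "z islimpt CB_deriv K b \<and> z \<in> A"
        using z A(1) islimpt_subset[of z "CB_deriv A b" "CB_deriv K b"]
        by (auto simp: closed_limpt eq)
    next
      assume z: "z islimpt CB_deriv K b \<and> z \<in> A"
      then have "eventually (\<lambda>w. w \<in> T) (at z)"
        using T eventually_at_in_open'[of T z] by auto
      then show "z islimpt CB_deriv A b"
        unfolding eqT using z by (metis islimpt_Int_eventually inf_commute)
    qed
    then show ?thesis
      by (auto simp: 2 CB_deriv_succ derived_set_def)
  next
    case 3
    \<comment> \<open>The index set of the intersection must be nonempty for intersecting with
      \<open>A\<close> to commute with it.\<close>
    then have "zero_cord < a"
      using zero_cord_le by (auto simp: limit_cord_def order_less_le)
    then show ?thesis using less 3 by (auto simp: CB_deriv_limit)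
  qed
qed

text \<open>A finite set has no limit points, so everything after a finite derivative is
  empty.\<close>

lemma infinite_CB_deriv_below:
  assumes "closed K" "b < a" "CB_deriv K a \<noteq> {}"
  shows "infinite (CB_deriv K b)"
proof
  assume "finite (CB_deriv K b)"
  then have "CB_deriv K (succ_cord b) = {}"
    by (simp add: CB_deriv_succ derived_set_def islimpt_finite)
  moreover have "CB_deriv K a \<subseteq> CB_deriv K (succ_cord b)"
    using assms by (intro CB_deriv_antimono) (auto simp: succ_cord_le_iff)
  ultimately show False
    using assms(3) by simp
qed

text \<open>Cantor's theorem: as there are uncountably many \<open>a :: cord\<close>, the derivatives cannot lose
  a point at every step.\<close>

lemma ex_CB_deriv_empty:
  assumes "closed K" "countable K"
  shows "\<exists>a. CB_deriv K a = {}"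
proof (rule ccontr)
  assume ne: "\<nexists>a. CB_deriv K a = {}"
  have "\<exists>z. z \<in> CB_deriv K a \<and> z \<notin> CB_deriv K (succ_cord a)" for a
  proof -
    have "countable (CB_deriv K a)"
      using CB_deriv_subset assms countable_subset by blast
    then obtain z where "z \<in> CB_deriv K a" "\<not> z islimpt CB_deriv K a"
      using countable_closed_ex_isolated[OF closed_CB_deriv[OF assms(1)]] ne by blast
    then show ?thesis
      by (auto simp: CB_deriv_succ derived_set_def)
  qed
  then obtain z where z: "\<And>a. z a \<in> CB_deriv K a" "\<And>a. z a \<notin> CB_deriv K (succ_cord a)"
    by metis
  have neq: "z a \<noteq> z b" if "a < b" for a b
    using z that CB_deriv_antimono[OF assms(1), of "succ_cord a" b]
    by (metis subsetD succ_cord_le_iff)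
  have "inj z"
    using neq by (metis injI linorder_neqE)
  moreover have "range z \<subseteq> K"
    using z CB_deriv_subset[OF assms(1)] by blast
  ultimately show False
    using assms(2) uncountable_cord by (metis countable_image_inj_on countable_subset)
qed

text \<open>The index \<open>e\<close> of the first empty derivative is not zero, and by compactness
  it is not a limit either. So it is a successor of some \<open>b\<close>, and the derivative at
  \<open>b\<close> is compact without limit points, hence finite.\<close>

lemma ex_CB_deriv_finite_nonempty:
  assumes "compact K" "countable K" "K \<noteq> {}"
  obtains a where "finite (CB_deriv K a)" "CB_deriv K a \<noteq> {}"
proof -
  have cl: "closed K"
    using assms compact_imp_closed by blast
  define e where "e = (LEAST a. CB_deriv K a = {})"
  have e: "CB_deriv K e = {}"
    unfolding e_def using ex_CB_deriv_empty[OF cl assms(2)] by (rule LeastI_ex)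
  have below: "CB_deriv K b \<noteq> {}" if "b < e" for b
    using that not_less_Least e_def by blast
  show thesis
  proof (cases e rule: cord_cases)
    case 1
    then show ?thesis using e assms(3) by (simp add: CB_deriv_zero)
  next
    case (2 b)
    have "compact (CB_deriv K b)"
      using assms(1) closed_CB_deriv[OF cl] CB_deriv_subset[OF cl]
      by (metis compact_Int_closed inf.absorb2)
    moreover have "\<not> z islimpt CB_deriv K b" for z
      using e by (auto simp: 2 CB_deriv_succ derived_set_def)
    ultimately have "finite (CB_deriv K b)"
      using Heine_Borel_imp_Bolzano_Weierstrass[of "CB_deriv K b" "CB_deriv K b"] by blast
    then show ?thesis
      using that below 2 less_succ_cord by blast
  next
    case 3
    then have zero: "zero_cord < e"
      using zero_cord_le by (auto simp: limit_cord_def order_less_le)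
    have "K \<inter> (\<Inter>c\<in>{..<e}. CB_deriv K c) \<noteq> {}"
    proof (rule compact_imp_fip_image[OF assms(1)])
      fix I assume I: "finite I" "I \<subseteq> {..<e}"
      show "K \<inter> (\<Inter>c\<in>I. CB_deriv K c) \<noteq> {}"
      \<comment> \<open>The derivatives decrease, so a finite intersection contains the one at
        \<open>Max I\<close>, which is meaningful only for nonempty \<open>I\<close>.\<close>
      proof (cases "I = {}")
        case True
        then show ?thesis using assms(3) by simp
      next
        case False
        then have M: "Max I < e" "\<And>c. c \<in> I \<Longrightarrow> c \<le> Max I"
          using I by auto
        then have "CB_deriv K (Max I) \<subseteq> K \<inter> (\<Inter>c\<in>I. CB_deriv K c)"
          using CB_deriv_antimono[OF cl M(2)] CB_deriv_subset[OF cl, of "Max I"]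
          by (intro Int_greatest INT_greatest)
        then show ?thesis
          using below[OF M(1)] by blast
      qed
    qed (rule closed_CB_deriv[OF cl])
    then show ?thesis
      using e 3 by (simp add: CB_deriv_limit)
  qed
qed

text \<open>All derivatives before a finite nonempty one are infinite, so the least index in
  \<open>CB\<close> is the one where the derivative is finite and nonempty.\<close>

lemma card_CB_deriv_CB:
  assumes "compact K" "countable K" "K \<noteq> {}" "CB K = (a, p)"
  shows "card (CB_deriv K a) = p" "p \<noteq> 0"
proof -
  obtain c where c: "finite (CB_deriv K c)" "CB_deriv K c \<noteq> {}"
    using ex_CB_deriv_finite_nonempty assms by blast
  have "(LEAST a. finite (CB_deriv K a)) = c"
  proof (rule Least_equality)
    show "c \<le> b" if "finite (CB_deriv K b)" for b
      using that c infinite_CB_deriv_below[OF compact_imp_closed[OF assms(1)], of b c]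
      by (meson not_less)
  qed (rule c)
  then have "a = c" "p = card (CB_deriv K c)"
    using assms(4) by (auto simp: CB_def)
  then show "card (CB_deriv K a) = p" "p \<noteq> 0"
    using c by auto
qed

section \<open>Clopen pieces with prescribed finite derivative\<close>

lemma ex_clopen_in_single:
  assumes K: "compact K" "countable K" and z: "z \<in> CB_deriv K b" "\<not> z islimpt CB_deriv K b"
    and U: "open U" "z \<in> U"
  obtains A where "clopen_in K A" "A \<subseteq> U" "CB_deriv K b \<inter> A = {z}"
proof -
  have zK: "z \<in> K"
    using z CB_deriv_subset[OF compact_imp_closed[OF K(1)]] by blast
  obtain T where T: "z \<in> T" "open T" "\<forall>w\<in>CB_deriv K b. w \<in> T \<longrightarrow> w = z"
    using z(2) by (metis islimptI)
  obtain A where "clopen_in K A" "z \<in> A" "A \<subseteq> U \<inter> T"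
    using countable_clopen_base[OF K(2) zK, of "U \<inter> T"] U T by blast
  then show thesis
    using that[of A] T z by blast
qed

text \<open>Points are added one at a time. A point \<open>m\<close> of the derivative outside
  \<open>B\<close> need not be isolated there, so it is first enclosed in a clopen \<open>C\<close>
  away from \<open>B\<close> and \<open>y\<close>; the derivative of \<open>C\<close> is countable
  and closed, hence has an isolated point \<open>z\<close>.\<close>

lemma ex_clopen_in_card:
  assumes K: "compact K" "countable K" and inf: "infinite (CB_deriv K b)"
  shows "\<exists>B. clopen_in K B \<and> y \<notin> B \<and> finite (CB_deriv K b \<inter> B) \<and> card (CB_deriv K b \<inter> B) = q"
proof (induction q)
  case 0
  show ?case
    by (intro exI[of _ "{}"]) simp
next
  case (Suc q)
  then obtain B where B: "clopen_in K B" "y \<notin> B" "finite (CB_deriv K b \<inter> B)"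
      "card (CB_deriv K b \<inter> B) = q"
    by blast
  have cl: "closed K"
    using K compact_imp_closed by blast
  have clB: "closed B"
    using B cl closedin_closed_trans by blast
  have "infinite (CB_deriv K b - CB_deriv K b \<inter> B - {y})"
    using inf B(3) by (metis Diff_infinite_finite finite.emptyI finite.insertI)
  then obtain m where "m \<in> CB_deriv K b - CB_deriv K b \<inter> B - {y}"
    by (metis ex_in_conv finite.emptyI)
  then have m: "m \<in> CB_deriv K b" "m \<notin> B" "m \<noteq> y"
    by auto
  then have "m \<in> K"
    using CB_deriv_subset[OF cl] by blast
  moreover have "open (- (B \<union> {y}))"
    using clB by (simp add: open_Compl closed_Un)
  ultimately obtain C where C: "clopen_in K C" "m \<in> C" "C \<subseteq> - (B \<union> {y})"
    using countable_clopen_base[OF K(2), of m "- (B \<union> {y})"] m by auto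
  have cptC: "compact C" and cntC: "countable C"
    using clopen_in_compact[OF K(1) C(1)] countable_subset[OF clopen_in_subset[OF C(1)] K(2)]
    by auto
  have DC: "CB_deriv C b = CB_deriv K b \<inter> C"
    by (rule CB_deriv_clopen_in[OF cl C(1)])
  have clC: "closed C"
    using cptC compact_imp_closed by blast
  have "closed (CB_deriv C b)" "countable (CB_deriv C b)"
    using closed_CB_deriv[OF clC] countable_subset[OF CB_deriv_subset[OF clC] cntC] by auto
  moreover have "CB_deriv C b \<noteq> {}"
    using DC m C by blast
  ultimately obtain z where z: "z \<in> CB_deriv C b" "\<not> z islimpt CB_deriv C b"
    using countable_closed_ex_isolated by blast
  then obtain A where A: "clopen_in C A" "CB_deriv C b \<inter> A = {z}"
    using ex_clopen_in_single[OF cptC cntC z, of UNIV] by auto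
  have AC: "A \<subseteq> C"
    using A clopen_in_subset by blast
  have "clopen_in K A"
    using A C clopen_in_trans by blast
  moreover have "CB_deriv K b \<inter> (B \<union> A) = insert z (CB_deriv K b \<inter> B)"
    using A(2) AC DC by blast
  moreover have "z \<notin> B"
    using A(2) AC C(3) by blast
  ultimately show ?case
    using B AC C(3) by (intro exI[of _ "B \<union> A"]) auto
qed

subsection \<open>Back and forth\<close>

text \<open>As infinite sets have \<^const>\<open>card\<close> 0, a nonzero cardinality makes the derivative finite and
  nonempty, so \<open>b\<close> is then the rank.\<close>

definition CB_card_determines :: "cord \<Rightarrow> bool"
  where "CB_card_determines b \<longleftrightarrow> (\<forall>K L. compact K \<longrightarrow> countable K \<longrightarrow> compact L \<longrightarrow> countable L \<longrightarrow>
    card (CB_deriv K b) = card (CB_deriv L b) \<longrightarrow> card (CB_deriv K b) \<noteq> 0 \<longrightarrow> K homeomorphic L)"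

lemma CB_card_determinesD:
  assumes "CB_card_determines b" "compact K" "countable K" "compact L" "countable L"
    and "card (CB_deriv K b) = card (CB_deriv L b)" "card (CB_deriv K b) \<noteq> 0"
  shows "K homeomorphic L"
  using assms unfolding CB_card_determines_def by blast

text \<open>One half of a back-and-forth step.\<close>

lemma extend_matching:
  assumes IH: "\<And>b. b < a \<Longrightarrow> CB_card_determines b"
    and K: "compact K" "countable K" "CB_deriv K a = {x}"
    and L: "compact L" "countable L" "CB_deriv L a = {y}"
    and A: "clopen_in K A" "x \<notin> A" and B: "clopen_in L B" "y \<notin> B"
    and z: "z \<in> K" "z \<noteq> x"
  shows "\<exists>A' B'. clopen_in K A' \<and> x \<notin> A' \<and> A \<subseteq> A' \<and> z \<in> A' \<and>
    clopen_in L B' \<and> y \<notin> B' \<and> B \<subseteq> B' \<and> (A' - A) homeomorphic (B' - B)"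
proof (cases "z \<in> A")
  case True
  then show ?thesis
    using A B by (intro exI[of _ A] exI[of _ B]) auto
next
  case False
  have clK: "closed K" and clL: "closed L"
    using K L compact_imp_closed by auto
  have "closed A"
    using A clK closedin_closed_trans by blast
  then have "open (- (A \<union> {x}))"
    by (simp add: open_Compl closed_Un)
  then obtain C where C: "clopen_in K C" "z \<in> C" "C \<subseteq> - (A \<union> {x})"
    using countable_clopen_base[OF K(2) z(1), of "- (A \<union> {x})"] z False by auto
  have cptC: "compact C" and cntC: "countable C"
    using clopen_in_compact[OF K(1) C(1)] countable_subset[OF clopen_in_subset[OF C(1)] K(2)]
    by auto
  obtain b where b: "finite (CB_deriv C b)" "CB_deriv C b \<noteq> {}"
    using ex_CB_deriv_finite_nonempty[OF cptC cntC] C(2) by blast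
  \<comment> \<open>\<open>C\<close> misses \<open>x\<close>, the only point of the
    \<open>a\<close>-th derivative, so its rank \<open>b\<close> is below \<open>a\<close>.\<close>
  have "CB_deriv C a = {}"
    using CB_deriv_clopen_in[OF clK C(1), of a] C(3) K(3) by auto
  then have "b < a"
    using b(2) CB_deriv_antimono[OF compact_imp_closed[OF cptC], of a b] by (auto simp: not_le[symmetric])
  have L': "clopen_in L (L - B)"
    using B(1) by (rule clopen_in_Compl)
  have cptL': "compact (L - B)" and cntL': "countable (L - B)"
    using clopen_in_compact[OF L(1) L'] L(2) by auto
  have "y \<in> L"
    using L(3) CB_deriv_subset[OF clL] by blast
  \<comment> \<open>Removing \<open>B\<close> keeps \<open>y\<close>, so enough points of lower rank
    remain to host a copy of \<open>C\<close>.\<close>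
  then have "CB_deriv (L - B) a \<noteq> {}"
    using CB_deriv_clopen_in[OF clL L'] L(3) B(2) by auto
  then have "infinite (CB_deriv (L - B) b)"
    using infinite_CB_deriv_below compact_imp_closed[OF cptL'] \<open>b < a\<close> by blast
  then obtain E where E: "clopen_in (L - B) E" "y \<notin> E"
      "card (CB_deriv (L - B) b \<inter> E) = card (CB_deriv C b)"
    using ex_clopen_in_card[OF cptL' cntL'] by metis
  have "C homeomorphic E"
  proof (rule CB_card_determinesD[OF IH[OF \<open>b < a\<close>] cptC cntC])
    show "compact E"
      using clopen_in_compact[OF cptL'] E by blast
    show "countable E"
      using clopen_in_subset E(1) cntL' countable_subset by metis
    show "card (CB_deriv C b) = card (CB_deriv E b)"
      using E(3) CB_deriv_clopen_in[OF compact_imp_closed[OF cptL'] E(1)] by simp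
    show "card (CB_deriv C b) \<noteq> 0"
      using b by simp
  qed
  moreover have "E \<subseteq> L - B"
    using E clopen_in_subset by blast
  then have "B \<union> E - B = E"
    by blast
  moreover have "A \<union> C - A = C"
    using C by blast
  moreover have "clopen_in L E"
    using clopen_in_trans[OF E(1) L'] .
  ultimately show ?thesis
    using A B C E by (intro exI[of _ "A \<union> C"] exI[of _ "B \<union> E"]) auto
qed

lemma homeomorphic_single:
  assumes IH: "\<And>b. b < a \<Longrightarrow> CB_card_determines b"
    and K: "compact K" "countable K" "CB_deriv K a = {x}"
    and L: "compact L" "countable L" "CB_deriv L a = {y}"
  shows "K homeomorphic L"
proof -
  have x: "x \<in> K" and y: "y \<in> L"
    using K L CB_deriv_subset compact_imp_closed by blast+
  \<comment> \<open>These enumerations may repeat values, so finite sets are covered as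
    well.\<close>
  define k where "k = from_nat_into K"
  define l where "l = from_nat_into L"
  have k: "range k = K" and l: "range l = L"
    using x y K L unfolding k_def l_def by (auto intro!: range_from_nat_into)
  \<comment> \<open>A state is the pair of parts already used up. Homeomorphisms are required only
    between successive increments, which become the matching pieces.\<close>
  define St where "St = (\<lambda>(A, B). clopen_in K A \<and> x \<notin> A \<and> clopen_in L B \<and> y \<notin> B)"
  define Next where "Next n = (\<lambda>(A, B) (A', B'). A \<subseteq> A' \<and> B \<subseteq> B' \<and>
      (A' - A) homeomorphic (B' - B) \<and> (k n \<noteq> x \<longrightarrow> k n \<in> A') \<and> (l n \<noteq> y \<longrightarrow> l n \<in> B'))" for n :: nat
  have step: "\<exists>S'. St S' \<and> Next n S S'" if S0: "St S" for n S
  proof -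
    obtain A B where S: "S = (A, B)" "clopen_in K A" "x \<notin> A" "clopen_in L B" "y \<notin> B"
      using S0 unfolding St_def by (cases S) auto
    have "\<exists>A1 B1. clopen_in K A1 \<and> x \<notin> A1 \<and> A \<subseteq> A1 \<and> (k n \<noteq> x \<longrightarrow> k n \<in> A1) \<and>
        clopen_in L B1 \<and> y \<notin> B1 \<and> B \<subseteq> B1 \<and> (A1 - A) homeomorphic (B1 - B)"
    proof (cases "k n = x")
      case True
      then show ?thesis
        using S by (intro exI[of _ A] exI[of _ B]) auto
    next
      case False
      then show ?thesis
        using extend_matching[OF IH K L S(2-5), of "k n"] k by blast
    qed
    then obtain A1 B1 where 1: "clopen_in K A1" "x \<notin> A1" "A \<subseteq> A1" "k n \<noteq> x \<longrightarrow> k n \<in> A1"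
        "clopen_in L B1" "y \<notin> B1" "B \<subseteq> B1" "(A1 - A) homeomorphic (B1 - B)"
      by blast
    have "\<exists>A2 B2. clopen_in K A2 \<and> x \<notin> A2 \<and> A1 \<subseteq> A2 \<and> (l n \<noteq> y \<longrightarrow> l n \<in> B2) \<and>
        clopen_in L B2 \<and> y \<notin> B2 \<and> B1 \<subseteq> B2 \<and> (A2 - A1) homeomorphic (B2 - B1)"
    proof (cases "l n = y")
      case True
      then show ?thesis
        using 1 by (intro exI[of _ A1] exI[of _ B1]) auto
    next
      case False
      then have "l n \<in> L" "l n \<noteq> y"
        using l by auto
      \<comment> \<open>The backward half exchanges the roles of \<open>K\<close> and
        \<open>L\<close>, so the resulting homeomorphism has to be reversed.\<close>
      from extend_matching[OF IH L K 1(5,6,1,2) this]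
      show ?thesis
        using homeomorphic_sym by blast
    qed
    then obtain A2 B2 where 2: "clopen_in K A2" "x \<notin> A2" "A1 \<subseteq> A2" "l n \<noteq> y \<longrightarrow> l n \<in> B2"
        "clopen_in L B2" "y \<notin> B2" "B1 \<subseteq> B2" "(A2 - A1) homeomorphic (B2 - B1)"
      by blast
    \<comment> \<open>The forward and backward increments are glued into a single one.\<close>
    have eqs: "A2 - A - (A1 - A) = A2 - A1" "B2 - B - (B1 - B) = B2 - B1"
      using 1 2 by auto
    have "(A2 - A) homeomorphic (B2 - B)"
    proof (rule homeomorphic_Un_clopen)
      show "compact (A2 - A)"
        by (rule clopen_in_compact[OF K(1) clopen_in_Diff[OF 2(1) S(2)]])
      show "clopen_in (A2 - A) (A1 - A)"
      proof -
        have "clopen_in K (A1 - A)" "A1 - A \<subseteq> A2 - A" "A2 - A \<subseteq> K"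
          using clopen_in_Diff[OF 1(1) S(2)] 2(3) clopen_in_subset[OF 2(1)] by auto
        then show ?thesis
          by (meson openin_subset_trans closedin_subset_trans)
      qed
      show "clopen_in (B2 - B) (B1 - B)"
      proof -
        have "clopen_in L (B1 - B)" "B1 - B \<subseteq> B2 - B" "B2 - B \<subseteq> L"
          using clopen_in_Diff[OF 1(5) S(4)] 2(7) clopen_in_subset[OF 2(5)] by auto
        then show ?thesis
          by (meson openin_subset_trans closedin_subset_trans)
      qed
    qed (use 1 2 eqs in auto)
    then show ?thesis
      using 1 2 by (intro exI[of _ "(A2, B2)"]) (auto simp: St_def Next_def S(1))
  qed
  \<comment> \<open>Dependent choice. The clause for \<open>n = 0\<close> starts the sequence at
    empty sets, so that the increments alone exhaust the unions.\<close>
  have "\<exists>S. \<forall>n. (St (S n) \<and> (n = 0 \<longrightarrow> S n = ({}, {}))) \<and> Next n (S n) (S (Suc n))"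
  proof (rule dependent_nat_choice)
    show "\<exists>S. St S \<and> (0 = (0::nat) \<longrightarrow> S = ({}, {}))"
      by (auto simp: St_def)
  qed (use step in blast)
  then obtain S where S: "\<And>n. St (S n)" "S 0 = ({}, {})" "\<And>n. Next n (S n) (S (Suc n))"
    by blast
  define A where "A n = fst (S n)" for n
  define B where "B n = snd (S n)" for n
  have A: "clopen_in K (A n)" "x \<notin> A n" and B: "clopen_in L (B n)" "y \<notin> B n" for n
    using S(1)[of n] by (auto simp: St_def A_def B_def split_def)
  have N: "A n \<subseteq> A (Suc n)" "B n \<subseteq> B (Suc n)" "(A (Suc n) - A n) homeomorphic (B (Suc n) - B n)"
      "k n \<noteq> x \<Longrightarrow> k n \<in> A (Suc n)" "l n \<noteq> y \<Longrightarrow> l n \<in> B (Suc n)" for n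
    using S(3)[of n] by (auto simp: Next_def A_def B_def split_def)
  have A0: "A 0 = {}" and B0: "B 0 = {}"
    by (simp_all add: A_def B_def S(2))
  have diffs: "disjoint_family (\<lambda>n. X (Suc n) - X n)" "(\<Union>n. X (Suc n) - X n) = (\<Union>n. X n)"
    if X: "\<And>n. X n \<subseteq> X (Suc n)" "X 0 = {}" for X :: "nat \<Rightarrow> real set"
  proof -
    have mono: "X m \<subseteq> X n" if "m \<le> n" for m n
      using that X(1) by (rule lift_Suc_mono_le[rotated])
    show "disjoint_family (\<lambda>n. X (Suc n) - X n)"
      using X(1) by (rule disjoint_family_Suc)
    have "z \<in> (\<Union>n. X (Suc n) - X n)" if "z \<in> X n" for z n
      using that by (induction n) (use X(2) in auto)
    then show "(\<Union>n. X (Suc n) - X n) = (\<Union>n. X n)"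
      by auto
  qed
  have UA: "(\<Union>n. A n) = K - {x}"
  proof (intro equalityI subsetI)
    show "z \<in> K - {x}" if "z \<in> (\<Union>n. A n)" for z
      using that A(2) clopen_in_subset[OF A(1)] by auto
    show "z \<in> (\<Union>n. A n)" if z: "z \<in> K - {x}" for z
    proof -
      obtain n where "z = k n"
        using z k by auto
      then show ?thesis
        using N(4)[of n] z by auto
    qed
  qed
  have UB: "(\<Union>n. B n) = L - {y}"
  proof (intro equalityI subsetI)
    show "z \<in> L - {y}" if "z \<in> (\<Union>n. B n)" for z
      using that B(2) clopen_in_subset[OF B(1)] by auto
    show "z \<in> (\<Union>n. B n)" if z: "z \<in> L - {y}" for z
    proof -
      obtain n where "z = l n"
        using z l by auto
      then show ?thesis
        using N(5)[of n] z by auto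
    qed
  qed
  show ?thesis
  proof (rule homeomorphic_one_point_compactification[OF K(1) L(1) x y])
    show "clopen_in K (A (Suc n) - A n)" "clopen_in L (B (Suc n) - B n)" for n
      using A B clopen_in_Diff by blast+
  qed (use diffs[of A, OF N(1) A0] diffs[of B, OF N(2) B0] UA UB N(3) in auto)
qed

text \<open>Inside the induction on the rank runs one on the number of points of the
  \<open>a\<close>-th derivative, starting from one point. Each step splits off a clopen piece
  around a single point of it; that piece is handled by \<open>homeomorphic_single\<close>, the
  remainder by the inner hypothesis.\<close>

lemma CB_card_determines: "CB_card_determines a"
proof (induction a rule: less_induct)
  case (less a)
  have main: "K homeomorphic L"
    if "compact K" "countable K" "compact L" "countable L"
      "card (CB_deriv K a) = Suc p" "card (CB_deriv L a) = Suc p" for p K L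
    using that
  proof (induction p arbitrary: K L)
    case 0
    then obtain x y where "CB_deriv K a = {x}" "CB_deriv L a = {y}"
      by (auto simp: card_Suc_eq)
    then show ?case
      using homeomorphic_single[OF less.IH] 0 by blast
  next
    case (Suc p)
    have split: "\<exists>A. clopen_in K A \<and> card (CB_deriv A a) = 1 \<and> card (CB_deriv (K - A) a) = Suc p"
      if K: "compact K" "countable K" and c: "card (CB_deriv K a) = Suc (Suc p)" for K
    proof -
      have cl: "closed K"
        using K compact_imp_closed by blast
      have fin: "finite (CB_deriv K a)"
        using c by (metis card.infinite nat.distinct(1))
      obtain z where z: "z \<in> CB_deriv K a"
        using c by fastforce
      then obtain A where A: "clopen_in K A" "CB_deriv K a \<inter> A = {z}"
        using ex_clopen_in_single[OF K z, of UNIV] islimpt_finite[OF fin] by auto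
      have "clopen_in K (K - A)"
        using A(1) by (rule clopen_in_Compl)
      then have "CB_deriv (K - A) a = CB_deriv K a \<inter> (K - A)"
        using CB_deriv_clopen_in[OF cl] by blast
      also have "\<dots> = CB_deriv K a - {z}"
        using A(2) CB_deriv_subset[OF cl] by blast
      finally have "card (CB_deriv (K - A) a) = Suc p"
        using z c fin by simp
      moreover have "CB_deriv A a = {z}"
        using CB_deriv_clopen_in[OF cl A(1)] A(2) by simp
      ultimately show ?thesis
        using A(1) by auto
    qed
    obtain A where A: "clopen_in K A" "card (CB_deriv A a) = 1" "card (CB_deriv (K - A) a) = Suc p"
      using split[of K] Suc.prems by blast
    obtain B where B: "clopen_in L B" "card (CB_deriv B a) = 1" "card (CB_deriv (L - B) a) = Suc p"
      using split[of L] Suc.prems by blast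
    have cpt: "compact A" "compact B" "compact (K - A)" "compact (L - B)"
      using clopen_in_compact[OF Suc.prems(1)] clopen_in_compact[OF Suc.prems(3)]
        A(1) B(1) clopen_in_Compl by blast+
    have cnt: "countable A" "countable B" "countable (K - A)" "countable (L - B)"
      using Suc.prems(2,4) clopen_in_subset[OF A(1)] clopen_in_subset[OF B(1)] countable_subset
      by auto
    obtain x y where "CB_deriv A a = {x}" "CB_deriv B a = {y}"
      using A(2) B(2) by (meson card_1_singletonE)
    then have "A homeomorphic B"
      using homeomorphic_single[OF less.IH] cpt cnt by blast
    moreover have "(K - A) homeomorphic (L - B)"
      using Suc.IH cpt cnt A(3) B(3) by blast
    ultimately show ?case
      using homeomorphic_Un_clopen Suc.prems(1) A(1) B(1) by blast
  qed
  then show ?case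
    unfolding CB_card_determines_def by (metis not0_implies_Suc)
qed

theorem theorem3p3:
  fixes K1 K2 :: "real set"
  assumes "K1 \<in> compact_countable_sets"
    and "K2 \<in> compact_countable_sets"
    and "CB K1 = CB K2"
  shows "K1 \<sim>\<^sub>K K2"
proof -
  have K: "compact K1" "countable K1" "compact K2" "countable K2"
    using assms by (auto simp: compact_countable_sets_def)
  have CB_empty: "snd (CB {}) = 0"
  proof -
    have "CB_deriv {} a = {}" for a
      using CB_deriv_subset[of "{}"] by auto
    then show ?thesis
      by (simp add: CB_def)
  qed
  obtain a p where ap: "CB K1 = (a, p)" "CB K2 = (a, p)"
    using assms(3) by (metis surj_pair)
  have "K1 homeomorphic K2"
  \<comment> \<open>\<open>CB_card_determines\<close> needs a nonzero cardinality. The empty set has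
    \<open>p = 0\<close> and a nonempty one does not, so equal characteristics make both sets empty
    or neither.\<close>
  proof (cases "K1 = {} \<or> K2 = {}")
    case True
    then have "p = 0"
      using CB_empty ap by auto
    then have "K1 = {}" "K2 = {}"
      using card_CB_deriv_CB(2) K ap by blast+
    then show ?thesis by simp
  next
    case False
    then show ?thesis
      using card_CB_deriv_CB[OF K(1,2) _ ap(1)] card_CB_deriv_CB[OF K(3,4) _ ap(2)]
        CB_card_determinesD[OF CB_card_determines K, of a] by simp
  qed
  then show ?thesis
    unfolding cont_bij_equiv_def homeomorphic_def homeomorphism_def bij_betw_def inj_on_def
    by metis
qed

end
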